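(* For $j=1,2$, let $(f_j,W_j)$ be chordal ($\mathbb{H}$-)Loewner pairs generated by the curves $\gamma_j:[0,T]\to\overline{\mathbb{H}}$, and assume that $$\sup_{t\in[0,T]}|W_1(t)-W_2(t)|\le\varepsilon .$$ Suppose that there exist $d_0>0$, $c<\infty$ and $\beta<1$ such that for $j=1,2$ $$\sup_{t\in[0,T]}d\,|f_j'(t,W_j(t)+id)|\le c\,d^{1-\beta}\qquad\text{for all } d\le d_0 .$$ Then for every $$r<2\,\frac{1-\beta}{3-\beta}$$ there exist $c'=c'(r,T)<\infty$ and $\varepsilon_0=\varepsilon_0(r,T)>0$ such that if $\varepsilon<\varepsilon_0$, then $$\sup_{t\in[0,T]}|\gamma_1(t)-\gamma_2(t)|\le c'\,\varepsilon^{r}.$$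
   Context: An $\mathbb{H}$-Loewner pair $(f,W)$ consists of a continuous $W:[0,\infty)\to\mathbb{R}$ and the solution $f(t,z)$ of the chordal Loewner equation $\partial_t f(t,z)=-f'(t,z)\frac{2}{z-W(t)}$, $f(0,z)=z$, $z\in\mathbb{H}=\{\operatorname{Im}z>0\}$, where $f'=\partial_z f$. It is generated by a curve $\gamma$ if $\gamma$ is continuous, $\gamma(t)=\lim_{d\to0+}f(t,W(t)+id)$, and $f(t,\mathbb{H})$ is the unbounded connected component of $\mathbb{H}\setminus\gamma[0,t]$ for every $t$. Curves carry this (half-plane capacity) parameterization. Here $T<\infty$ and $\varepsilon>0$. A constant written $c(a,b)$ is understood to depend only on the listed parameters.
   Formalization: Here c' depends only on r and T, but ε_0 may also depend on c, d_0 and β; with both constants depending on r and T alone the claim fails (smooth curves passing, or not, through an arbitrarily narrow gap into a pocket). *)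

theory Defs
  imports "HOL-Complex_Analysis.Complex_Analysis"
begin

definition upper_half_plane :: "complex set" where
  "upper_half_plane = {z. Im z > 0}"

text \<open>
  ``Solution of the Loewner equation'' is read classically: each map is holomorphic on the
  half-plane, and joint continuity in (t, z) is included so that the solution is unique
  (the right-hand side is then continuous as well, and the method of characteristics applies).
  At time 0 the time derivative is one-sided.
\<close>
definition loewner_pair :: "(real \<Rightarrow> complex \<Rightarrow> complex) \<Rightarrow> (real \<Rightarrow> real) \<Rightarrow> bool" where
  "loewner_pair f W \<longleftrightarrow>
     continuous_on {0..} W \<and>
     continuous_on ({0..} \<times> upper_half_plane) (\<lambda>(t, z). f t z) \<and>
     (\<forall>t\<ge>0. f t holomorphic_on upper_half_plane) \<and>
     (\<forall>z\<in>upper_half_plane. f 0 z = z) \<and>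
     (\<forall>t\<ge>0. \<forall>z\<in>upper_half_plane.
        ((\<lambda>s. f s z) has_vector_derivative
           - deriv (f t) z * (2 / (z - of_real (W t)))) (at t within {0..}))"

text \<open>
  Since the trace is compact, the half-plane minus the trace has exactly one unbounded component,
  so membership in components together with unboundedness identifies it.
\<close>
definition generated_by_curve ::
  "real \<Rightarrow> (real \<Rightarrow> complex \<Rightarrow> complex) \<Rightarrow> (real \<Rightarrow> real) \<Rightarrow> (real \<Rightarrow> complex) \<Rightarrow> bool" where
  "generated_by_curve T f W \<gamma> \<longleftrightarrow>
     continuous_on {0..T} \<gamma> \<and>
     (\<forall>t\<in>{0..T}. Im (\<gamma> t) \<ge> 0) \<and>
     (\<forall>t\<in>{0..T}. ((\<lambda>d. f t (of_real (W t) + \<i> * of_real d)) \<longlongrightarrow> \<gamma> t) (at_right 0)) \<and>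
     (\<forall>t\<in>{0..T}.
        f t ` upper_half_plane \<in> components (upper_half_plane - \<gamma> ` {0..t}) \<and>
        \<not> bounded (f t ` upper_half_plane))"

end

theory Submission
  imports Defs "HOL-Real_Asymp.Real_Asymp"
begin

text \<open>
  Fix a time t and run the Loewner equation backwards from it: the characteristics of the partial
  differential equation are the solutions of h'(s) = - 2 / (h(s) - U(s)) with U(s) = W(t - s), and
  f(t, z) = h(t) for the one with h(0) = z.  Along such a backward flow write v = 1 / (h - U).
  Everything needed about f is then an exact formula: f'(t, z) is the exponential of the integral
  of 2 v^2, and the derivative of ln (Im h) is 2 |v|^2.  Adding the two,
  ln (|f'(t, z)| Im h(t) / Im h(0)) is the integral of 4 (Re v)^2.

  For two flows the difference H = h1 - h2 solves the linear equation
  H' = 2 v1 v2 (H - (U1 - U2)).  The real part of 2 v1 v2 is at most 2 (Re v1) (Re v2), because both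
  v1 and v2 have negative imaginary part, hence at most (Re v1)^2 + (Re v2)^2; and this is one
  quarter of the sum of the two integrands 4 (Re v)^2.  So the amplification of an error of size \<epsilon> is
  governed by the square root of the geometric mean of the two quantities |f_j'| Im h_j(t) / Im h_j(0),
  up to a logarithm coming from the integral of |2 v1 v2| (lemma backward_flow_compare).

  Both flows are started at distance d above their own driving point, at W_j(t) + i d.  The starting
  points then differ by at most \<epsilon>, and the derivative bound applies at precisely these points.
  The hypothesis |f_j'| \<le> c d^(-\<beta>) gives
  |f_1(t, W_1(t) + i d) - f_2(t, W_2(t) + i d)| \<le> C \<epsilon> d^(-(1 + \<beta>) / 2) (1 + ln (1 / d)), while
  integrating it down to the boundary gives |\<gamma>_j(t) - f_j(t, W_j(t) + i d)| \<le> c d^(1 - \<beta>) / (1 - \<beta>).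
  The two are balanced by d = \<epsilon>^(2 / (3 - \<beta>)), both being then \<epsilon>^(2 (1 - \<beta>) / (3 - \<beta>)) up to a
  logarithm and a constant.  As r is strictly smaller than this exponent, the
  logarithm and every constant are absorbed when \<epsilon> is small, and even c' = 1 is possible.

  The backward flow exists by Picard iteration.  That f is constant along characteristics needs
  differentiability of f in (t, z) jointly; this follows from the continuity of f' in (t, z), which
  Cauchy's inequality derives from the continuity of f.
\<close>

section \<open>Ordinary differential equations on an interval\<close>

text \<open>
  With f constant this says that a function with nonnegative derivative increases; all monotonicity
  arguments below use it in this form, with one-sided derivatives at the end points.
\<close>
lemma norm_increment_le:
  fixes f :: "real \<Rightarrow> 'a::real_normed_vector" and \<phi> :: "real \<Rightarrow> real"
  assumes "a \<le> b"
    and f: "\<And>s. s \<in> {a..b} \<Longrightarrow> (f has_vector_derivative f' s) (at s within {a..b})"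
    and \<phi>: "\<And>s. s \<in> {a..b} \<Longrightarrow> (\<phi> has_vector_derivative \<phi>' s) (at s within {a..b})"
    and le: "\<And>s. s \<in> {a..b} \<Longrightarrow> norm (f' s) \<le> \<phi>' s"
  shows "norm (f b - f a) \<le> \<phi> b - \<phi> a"
proof (cases "a = b")
  case False
  have inner: "(g has_vector_derivative D) (at s)"
    if "(g has_vector_derivative D) (at s within {a..b})" "a < s" "s < b"
    for g :: "real \<Rightarrow> 'c::real_normed_vector" and D s
    using that by (metis at_within_Icc_at)
  show ?thesis
  proof (rule differentiable_bound_general)
    show "continuous_on {a..b} f" "continuous_on {a..b} \<phi>"
      by (rule continuous_on_vector_derivative, rule f \<phi>, assumption)+
    show "(f has_vector_derivative f' s) (at s)" "(\<phi> has_vector_derivative \<phi>' s) (at s)"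
      if "a < s" "s < b" for s
      using that by (auto intro: inner[OF f] inner[OF \<phi>])
  qed (use False \<open>a \<le> b\<close> le in auto)
qed auto

text \<open>
  The successive differences of the Picard iterates are bounded by a multiple of 2^(-n) exp (2 L s).
  With this exponential weight one integration of the Lipschitz bound gains a factor 1/2,
  whatever the length of the interval.
\<close>
lemma global_picard_lindelof:
  fixes F :: "real \<Rightarrow> 'a::banach \<Rightarrow> 'a"
  assumes "0 \<le> t" "0 < L"
    and cont: "\<And>p. continuous_on {0..t} p \<Longrightarrow> continuous_on {0..t} (\<lambda>s. F s (p s))"
    and lip: "\<And>s x y. s \<in> {0..t} \<Longrightarrow> norm (F s x - F s y) \<le> L * norm (x - y)"
  obtains h where "h 0 = x0"
    and "\<And>s. s \<in> {0..t} \<Longrightarrow> (h has_vector_derivative F s (h s)) (at s within {0..t})"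
proof -
  define P where "P p s = x0 + integral {0..s} (\<lambda>u. F u (p u))" for p s
  define p where "p n = (P ^^ n) (\<lambda>_. x0)" for n
  have P_deriv: "(P q has_vector_derivative F s (q s)) (at s within {0..t})"
    if "continuous_on {0..t} q" "s \<in> {0..t}" for q s
    unfolding P_def using integral_has_vector_derivative[OF cont[OF that(1)] that(2)]
    by (auto intro!: derivative_eq_intros)
  have p_Suc: "p (Suc n) = P (p n)" for n
    by (simp add: p_def)
  have p_cont: "continuous_on {0..t} (p n)" for n
  proof (induction n)
    case (Suc n)
    show ?case
      unfolding p_Suc using P_deriv[OF Suc] by (intro continuous_on_vector_derivative)
  qed (simp add: p_def)
  have p_deriv: "(p (Suc n) has_vector_derivative F s (p n s)) (at s within {0..t})"
    if "s \<in> {0..t}" for n s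
    unfolding p_Suc using P_deriv[OF p_cont that] .
  have p_0: "p n 0 = x0" for n
    by (cases n) (auto simp: p_Suc P_def, simp add: p_def)
  obtain M where M: "\<And>s. s \<in> {0..t} \<Longrightarrow> norm (p 1 s - p 0 s) \<le> M"
  proof -
    have "continuous_on {0..t} (\<lambda>s. norm (p 1 s - p 0 s))"
      by (intro continuous_intros p_cont)
    then show ?thesis
      using continuous_attains_sup[of "{0..t}" "\<lambda>s. norm (p 1 s - p 0 s)"] \<open>0 \<le> t\<close> that
      by force
  qed
  have "0 \<le> M"
    using M[of 0] \<open>0 \<le> t\<close> order_trans[OF norm_ge_zero] by force
  have step: "norm (p (Suc n) s - p n s) \<le> M * (1/2)^n * exp (2 * L * s)"
    if "s \<in> {0..t}" for n s
    using that
  proof (induction n arbitrary: s)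
    case 0
    have "M * 1 \<le> M * exp (2 * L * s)"
      using 0 \<open>0 \<le> M\<close> \<open>0 < L\<close> by (intro mult_left_mono) auto
    then show ?case
      using M[OF 0] by simp
  next
    case (Suc n)
    let ?\<phi> = "\<lambda>s. M * (1/2)^(Suc n) * exp (2 * L * s)"
    have "norm ((p (Suc (Suc n)) s - p (Suc n) s) - (p (Suc (Suc n)) 0 - p (Suc n) 0)) \<le> ?\<phi> s - ?\<phi> 0"
    proof (rule norm_increment_le[where f = "\<lambda>s. p (Suc (Suc n)) s - p (Suc n) s" and \<phi> = ?\<phi>])
      fix u assume u: "u \<in> {0..s}"
      then have ut: "u \<in> {0..t}"
        using Suc.prems by auto
      have sub: "{0..s} \<subseteq> {0..t}"
        using Suc.prems by auto
      show "((\<lambda>s. p (Suc (Suc n)) s - p (Suc n) s) has_vector_derivative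
              (F u (p (Suc n) u) - F u (p n u))) (at u within {0..s})"
        using has_vector_derivative_within_subset[OF p_deriv[OF ut] sub]
        by (intro derivative_intros) auto
      show "(?\<phi> has_vector_derivative L * (M * (1/2)^n * exp (2 * L * u))) (at u within {0..s})"
        unfolding has_real_derivative_iff_has_vector_derivative[symmetric]
        by (auto intro!: derivative_eq_intros)
      show "norm (F u (p (Suc n) u) - F u (p n u)) \<le> L * (M * (1/2)^n * exp (2 * L * u))"
        using lip[OF ut] Suc.IH[OF ut] \<open>0 < L\<close>
        by (meson mult_left_mono less_imp_le order_trans)
    qed (use Suc.prems in auto)
    moreover have "0 \<le> ?\<phi> 0"
      using \<open>0 \<le> M\<close> by simp
    ultimately show ?case
      by (simp add: p_0)
  qed
  define h where "h s = x0 + (\<Sum>n. p (Suc n) s - p n s)" for s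
  have "uniform_limit {0..t} (\<lambda>n s. \<Sum>i<n. p (Suc i) s - p i s)
          (\<lambda>s. \<Sum>i. p (Suc i) s - p i s) sequentially"
  proof (rule Weierstrass_m_test)
    show "norm (p (Suc n) s - p n s) \<le> (M * exp (2 * L * t)) * (1/2)^n" if "s \<in> {0..t}" for n s
    proof -
      have "M * (1/2)^n * exp (2 * L * s) \<le> M * (1/2)^n * exp (2 * L * t)"
        using that \<open>0 \<le> M\<close> \<open>0 < L\<close> by (intro mult_left_mono) auto
      then show ?thesis
        using step[OF that, of n] by (simp add: mult_ac)
    qed
    show "summable (\<lambda>n. (M * exp (2 * L * t)) * (1/2::real)^n)"
      by (intro summable_mult summable_geometric) auto
  qed
  moreover have "(\<Sum>i<n. p (Suc i) s - p i s) = p n s - x0" for n s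
    using sum_lessThan_telescope[of "\<lambda>i. p i s" n] by (simp add: p_def)
  ultimately have "uniform_limit {0..t} (\<lambda>n s. x0 + (p n s - x0)) h sequentially"
    unfolding h_def by (intro uniform_limit_intros) auto
  then have lim: "uniform_limit {0..t} p h sequentially"
    by simp
  have h_cont: "continuous_on {0..t} h"
    by (rule uniform_limit_theorem[OF _ lim]) (use p_cont in auto)
  have F_lim: "uniform_limit {0..t} (\<lambda>n s. F s (p n s)) (\<lambda>s. F s (h s)) sequentially"
  proof (rule uniform_limitI)
    fix e :: real assume "0 < e"
    then have "\<forall>\<^sub>F n in sequentially. \<forall>s\<in>{0..t}. dist (p n s) (h s) < e / L"
      using \<open>0 < L\<close> by (intro uniform_limitD[OF lim]) auto
    then show "\<forall>\<^sub>F n in sequentially. \<forall>s\<in>{0..t}. dist (F s (p n s)) (F s (h s)) < e"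
    proof eventually_elim
      case (elim n)
      show ?case
      proof
        fix s assume s: "s \<in> {0..t}"
        have "norm (F s (p n s) - F s (h s)) \<le> L * norm (p n s - h s)"
          by (rule lip[OF s])
        also have "\<dots> < e"
          using elim s \<open>0 < L\<close> by (auto simp: dist_norm field_simps)
        finally show "dist (F s (p n s)) (F s (h s)) < e"
          by (simp add: dist_norm)
      qed
    qed
  qed
  have h_eq: "h s = P h s" if s: "s \<in> {0..t}" for s
  proof -
    have sub: "{0..s} \<subseteq> {0..t}"
      using s by auto
    obtain I J where I: "\<And>n. ((\<lambda>u. F u (p n u)) has_integral I n) {0..s}"
      and J: "((\<lambda>u. F u (h u)) has_integral J) {0..s}" and IJ: "I \<longlonglongrightarrow> J"
    proof (rule uniform_limit_integral)
      show "uniform_limit {0..s} (\<lambda>n u. F u (p n u)) (\<lambda>u. F u (h u)) sequentially"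
        using uniform_limit_on_subset[OF F_lim sub] .
      show "continuous_on {0..s} (\<lambda>u. F u (p n u))" for n
        using continuous_on_subset[OF cont[OF p_cont] sub] .
    qed auto
    have "(\<lambda>n. p (Suc n) s) = (\<lambda>n. x0 + I n)"
      using I by (auto simp: p_Suc P_def fun_eq_iff integral_unique)
    moreover have "(\<lambda>n. x0 + I n) \<longlonglongrightarrow> x0 + J"
      using IJ by (intro tendsto_intros)
    moreover have "(\<lambda>n. p (Suc n) s) \<longlonglongrightarrow> h s"
      using LIMSEQ_Suc[OF tendsto_uniform_limitI[OF lim s]] .
    ultimately have "h s = x0 + J"
      using LIMSEQ_unique by auto
    then show ?thesis
      using J by (simp add: P_def integral_unique)
  qed
  show ?thesis
  proof
    show "h 0 = x0"
      using h_eq[of 0] \<open>0 \<le> t\<close> by (simp add: P_def)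
    show "(h has_vector_derivative F s (h s)) (at s within {0..t})" if "s \<in> {0..t}" for s
      using has_vector_derivative_transform[OF that _ P_deriv[OF h_cont that]] h_eq by simp
  qed
qed

section \<open>The backward Loewner flow\<close>

text \<open>
  Continuity of the driving function is part of the predicate because every integral along a flow
  needs it; the initial value is left free, so that statements about a flow refer to it as h 0.
\<close>
definition backward_flow :: "(real \<Rightarrow> real) \<Rightarrow> real \<Rightarrow> (real \<Rightarrow> complex) \<Rightarrow> bool" where
  "backward_flow U t h \<longleftrightarrow>
     continuous_on {0..t} U \<and>
     (\<forall>s\<in>{0..t}. 0 < Im (h s) \<and>
        (h has_vector_derivative - (2 / (h s - of_real (U s)))) (at s within {0..t}))"

lemma norm_inverse_diff_le:
  fixes a b :: complex
  assumes "0 < y" "y \<le> Im a" "y \<le> Im b"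
  shows "norm (1 / a - 1 / b) \<le> norm (a - b) / y\<^sup>2"
proof -
  have ab: "y \<le> norm a" "y \<le> norm b"
    using assms abs_Im_le_cmod[of a] abs_Im_le_cmod[of b] by auto
  then have "a \<noteq> 0" "b \<noteq> 0"
    using assms(1) by auto
  then have "1 / a - 1 / b = (b - a) / (a * b)"
    by (simp add: divide_simps)
  then have "norm (1 / a - 1 / b) = norm (a - b) / (norm a * norm b)"
    by (simp add: norm_mult norm_divide norm_minus_commute)
  also have "\<dots> \<le> norm (a - b) / y\<^sup>2"
    unfolding power2_eq_square using ab assms(1) by (intro divide_left_mono mult_mono mult_pos_pos) auto
  finally show ?thesis .
qed

text \<open>
  The vector field is singular on the real axis, but it points upwards.  Replacing Im w by
  max y (Im w), where y is the initial height, makes it globally Lipschitz; the truncated solution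
  never descends below y and so solves the original equation.
\<close>
lemma backward_flow_exists:
  assumes "0 \<le> t" "continuous_on {0..t} U" "0 < Im z"
  obtains h where "backward_flow U t h" "h 0 = z"
proof -
  define y where "y = Im z"
  have y: "0 < y"
    using assms by (simp add: y_def)
  define tr where "tr w = Complex (Re w) (max y (Im w))" for w
  define F where "F s w = - (2 / (tr w - of_real (U s)))" for s w
  have Im_tr: "y \<le> Im (tr w - of_real (U s))" for w s
    by (simp add: tr_def)
  have tr_nz: "tr w - of_real (U s) \<noteq> 0" for w s
    using Im_tr[of w s] y by auto
  have tr_lip: "norm (tr a - tr b) \<le> norm (a - b)" for a b
    by (auto simp: tr_def cmod_def intro!: real_sqrt_le_mono add_mono simp flip: abs_le_square_iff)
  obtain h where h0: "h 0 = z"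
    and h': "\<And>s. s \<in> {0..t} \<Longrightarrow> (h has_vector_derivative F s (h s)) (at s within {0..t})"
  proof (rule global_picard_lindelof[of t "2 / y\<^sup>2" F z])
    show "continuous_on {0..t} (\<lambda>s. F s (p s))" if "continuous_on {0..t} p" for p
    proof -
      have "continuous_on {0..t} (\<lambda>s. tr (p s))"
        unfolding tr_def Complex_eq by (intro continuous_intros that)
      then show ?thesis
        unfolding F_def using tr_nz by (intro continuous_intros assms(2)) auto
    qed
    show "norm (F s a - F s b) \<le> 2 / y\<^sup>2 * norm (a - b)" for s a b
    proof -
      have "F s a - F s b = 2 * (1 / (tr b - of_real (U s)) - 1 / (tr a - of_real (U s)))"
        unfolding F_def by (simp add: right_diff_distrib)
      then have "norm (F s a - F s b) = 2 * norm (1 / (tr b - of_real (U s)) - 1 / (tr a - of_real (U s)))"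
        by (simp only: norm_mult norm_numeral)
      also have "\<dots> \<le> 2 * (norm (tr b - tr a) / y\<^sup>2)"
        using norm_inverse_diff_le[OF y Im_tr[where w = b and s = s] Im_tr[where w = a and s = s]] by simp
      also have "\<dots> \<le> 2 * (norm (b - a) / y\<^sup>2)"
        using tr_lip y by (intro mult_left_mono divide_right_mono) auto
      finally show ?thesis
        by (simp add: norm_minus_commute)
    qed
  qed (use assms y in auto)
  have "y \<le> Im (h s)" if s: "s \<in> {0..t}" for s
  proof -
    have "norm ((0::real) - 0) \<le> Im (h s) - Im (h 0)"
    proof (rule norm_increment_le[where f = "\<lambda>_. 0::real" and f' = "\<lambda>_. 0" and \<phi> = "\<lambda>s. Im (h s)"])
      fix u assume "u \<in> {0..s}"
      then have "(h has_vector_derivative F u (h u)) (at u within {0..s})"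
        using s by (intro has_vector_derivative_within_subset[OF h']) auto
      then show "((\<lambda>s. Im (h s)) has_vector_derivative Im (F u (h u))) (at u within {0..s})"
        by (rule bounded_linear.has_vector_derivative[OF bounded_linear_Im])
      show "norm (0::real) \<le> Im (F u (h u))"
        using Im_tr[of "h u" u] y by (simp add: F_def Im_divide)
    qed (use s in auto)
    then show ?thesis
      by (simp add: h0 y_def)
  qed
  then have "tr (h s) = h s \<and> 0 < Im (h s)" if "s \<in> {0..t}" for s
    using that y by (fastforce simp: tr_def complex_eq_iff)
  then have "backward_flow U t h"
    using h' assms(2) unfolding backward_flow_def F_def by metis
  then show ?thesis
    using h0 that by blast
qed

lemma backward_flow_restrict:
  assumes "backward_flow U t h" "0 \<le> s" "s \<le> t"
  shows "backward_flow U s h"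
proof -
  have sub: "{0..s} \<subseteq> {0..t}"
    using assms by auto
  show ?thesis
    using assms(1) has_vector_derivative_within_subset[OF _ sub] continuous_on_subset[OF _ sub] sub
    unfolding backward_flow_def by blast
qed

text \<open>
  In what follows v is half of the negative velocity of the flow.  It is the natural
  variable: the growth rates of the flow and of its derivative are quadratic in v.
\<close>
context
  fixes U :: "real \<Rightarrow> real" and t :: real and h v :: "real \<Rightarrow> complex"
  assumes flow: "backward_flow U t h"
  defines "v \<equiv> \<lambda>s. 1 / (h s - of_real (U s))"
begin

lemma backward_flow_deriv:
  "s \<in> {0..t} \<Longrightarrow> (h has_vector_derivative - 2 * v s) (at s within {0..t})"
  using flow by (auto simp: backward_flow_def v_def)

lemma backward_flow_nonzero: "s \<in> {0..t} \<Longrightarrow> h s - of_real (U s) \<noteq> 0"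
  using flow unfolding backward_flow_def by (metis Im_complex_of_real eq_iff_diff_eq_0 less_irrefl)

lemma backward_flow_Im_velocity:
  assumes "s \<in> {0..t}"
  shows "- Im (v s) = Im (h s) * (norm (v s))\<^sup>2"
proof -
  have "Im (v s) = - Im (h s) / (norm (h s - of_real (U s)))\<^sup>2"
    unfolding v_def by (simp add: Im_divide cmod_power2)
  then show ?thesis
    by (simp add: v_def norm_divide power_divide)
qed

lemma backward_flow_Im_velocity_neg: "s \<in> {0..t} \<Longrightarrow> Im (v s) < 0"
  using flow backward_flow_nonzero[of s] unfolding v_def backward_flow_def
  by (auto simp: Im_divide divide_simps sum_power2_gt_zero_iff complex_eq_iff)

lemma continuous_on_backward_flow: "continuous_on {0..t} h"
  by (rule continuous_on_vector_derivative, rule backward_flow_deriv)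

lemma continuous_on_backward_flow_velocity: "continuous_on {0..t} v"
  unfolding v_def using flow backward_flow_nonzero
  by (intro continuous_intros continuous_on_backward_flow) (auto simp: backward_flow_def)

lemma backward_flow_Im_deriv:
  assumes "s \<in> {0..t}"
  shows "((\<lambda>s. Im (h s)) has_vector_derivative - 2 * Im (v s)) (at s within {0..t})"
  using bounded_linear.has_vector_derivative[OF bounded_linear_Im backward_flow_deriv[OF assms]]
  by simp

lemma backward_flow_Im_increasing:
  assumes "s \<in> {0..t}"
  shows "Im (h 0) \<le> Im (h s)"
proof -
  have "norm ((0::real) - 0) \<le> Im (h s) - Im (h 0)"
  proof (rule norm_increment_le[where f = "\<lambda>_. 0::real" and f' = "\<lambda>_. 0" and \<phi> = "\<lambda>s. Im (h s)"])
    fix u assume u: "u \<in> {0..s}"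
    show "((\<lambda>s. Im (h s)) has_vector_derivative - 2 * Im (v u)) (at u within {0..s})"
      using assms u by (intro has_vector_derivative_within_subset[OF backward_flow_Im_deriv]) auto
    show "norm (0::real) \<le> - 2 * Im (v u)"
      using backward_flow_Im_velocity_neg[of u] u assms by auto
  qed (use assms in auto)
  then show ?thesis
    by simp
qed

lemma backward_flow_velocity_le:
  assumes "s \<in> {0..t}"
  shows "norm (v s) \<le> 1 / Im (h 0)"
proof -
  have "Im (h 0) \<le> norm (h s - of_real (U s))"
    using backward_flow_Im_increasing[OF assms] abs_Im_le_cmod[of "h s - of_real (U s)"] by simp
  moreover have "0 < Im (h 0)"
    using flow assms by (auto simp: backward_flow_def)
  ultimately show ?thesis
    unfolding v_def by (simp add: norm_divide frac_le)
qed

text \<open>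
  The derivative of (Im h)^2 is 4 (Im h)^2 |v|^2, which is at most 4.
\<close>
lemma backward_flow_Im_growth:
  assumes "s \<in> {0..t}"
  shows "(Im (h s))\<^sup>2 \<le> (Im (h 0))\<^sup>2 + 4 * s"
proof -
  have "norm ((Im (h s))\<^sup>2 - (Im (h 0))\<^sup>2) \<le> 4 * s - 4 * 0"
  proof (rule norm_increment_le[where f = "\<lambda>s. (Im (h s))\<^sup>2" and \<phi> = "\<lambda>s. 4 * s"])
    fix u assume u: "u \<in> {0..s}"
    then have ut: "u \<in> {0..t}"
      using assms by auto
    have "((\<lambda>s. Im (h s)) has_vector_derivative - 2 * Im (v u)) (at u within {0..s})"
      using assms by (intro has_vector_derivative_within_subset[OF backward_flow_Im_deriv[OF ut]]) auto
    then show "((\<lambda>s. (Im (h s))\<^sup>2) has_vector_derivative 4 * (Im (h u) * - Im (v u))) (at u within {0..s})"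
      unfolding has_real_derivative_iff_has_vector_derivative[symmetric]
      by (auto intro!: DERIV_cong[OF DERIV_power])
    show "((\<lambda>s. 4 * s) has_vector_derivative 4) (at u within {0..s})"
      unfolding has_real_derivative_iff_has_vector_derivative[symmetric]
      by (auto intro!: derivative_eq_intros)
    have "Im (h u) * norm (v u) \<le> 1"
      using abs_Im_le_cmod[of "h u - of_real (U u)"] backward_flow_nonzero[OF ut]
      by (simp add: v_def norm_divide divide_simps)
    moreover have "0 < Im (h u)"
      using flow ut by (auto simp: backward_flow_def)
    moreover have "Im (h u) * - Im (v u) = (Im (h u) * norm (v u))\<^sup>2"
      using backward_flow_Im_velocity[OF ut] by (simp add: power2_eq_square mult_ac)
    ultimately show "norm (4 * (Im (h u) * - Im (v u))) \<le> 4"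
      using power_le_one[of "Im (h u) * norm (v u)" 2] by (simp only: norm_mult) (auto simp: abs_mult)
  qed (use assms in auto)
  then show ?thesis
    by simp
qed

lemma backward_flow_ln_Im_deriv:
  assumes "s \<in> {0..t}"
  shows "((\<lambda>s. ln (Im (h s))) has_vector_derivative 2 * (norm (v s))\<^sup>2) (at s within {0..t})"
proof -
  have "0 < Im (h s)"
    using flow assms by (auto simp: backward_flow_def)
  moreover have "-2 * Im (v s) = 2 * (norm (v s))\<^sup>2 * Im (h s)"
    using backward_flow_Im_velocity[OF assms] by simp
  ultimately have "inverse (Im (h s)) * (- 2 * Im (v s)) = 2 * (norm (v s))\<^sup>2"
    by (simp add: field_simps)
  moreover have "((\<lambda>s. ln (Im (h s))) has_real_derivative inverse (Im (h s)) * (- 2 * Im (v s)))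
      (at s within {0..t})"
    using backward_flow_Im_deriv[OF assms]
    unfolding has_real_derivative_iff_has_vector_derivative[symmetric]
    by (rule DERIV_chain2[where f = ln and g = "\<lambda>s. Im (h s)", OF DERIV_ln[OF \<open>0 < Im (h s)\<close>]])
  ultimately show ?thesis
    unfolding has_real_derivative_iff_has_vector_derivative[symmetric] by metis
qed

end

text \<open>
  The difference H of two flows satisfies the linear equation H' = 2 v1 v2 (H - (U1 - U2));
  exp (- \<Psi>) is its integrating factor.
\<close>
lemma backward_flow_diff_deriv:
  assumes flow1: "backward_flow U\<^sub>1 t h\<^sub>1" and flow2: "backward_flow U\<^sub>2 t h\<^sub>2" and s: "s \<in> {0..t}"
  defines "v\<^sub>1 \<equiv> \<lambda>s. 1 / (h\<^sub>1 s - of_real (U\<^sub>1 s))" and "v\<^sub>2 \<equiv> \<lambda>s. 1 / (h\<^sub>2 s - of_real (U\<^sub>2 s))"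
  defines "\<Psi> \<equiv> \<lambda>s. integral {0..s} (\<lambda>u. 2 * (v\<^sub>1 u * v\<^sub>2 u))"
  shows "((\<lambda>s. exp (- \<Psi> s) * (h\<^sub>1 s - h\<^sub>2 s)) has_vector_derivative
            - exp (- \<Psi> s) * (2 * (v\<^sub>1 s * v\<^sub>2 s)) * of_real (U\<^sub>1 s - U\<^sub>2 s)) (at s within {0..t})"
proof -
  have cont: "continuous_on {0..t} (\<lambda>u. 2 * (v\<^sub>1 u * v\<^sub>2 u))"
    using continuous_on_backward_flow_velocity[OF flow1] continuous_on_backward_flow_velocity[OF flow2]
    unfolding v\<^sub>1_def v\<^sub>2_def by (intro continuous_on_mult continuous_on_const)
  have \<Psi>': "(\<Psi> has_vector_derivative 2 * (v\<^sub>1 s * v\<^sub>2 s)) (at s within {0..t})"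
    unfolding \<Psi>_def by (rule integral_has_vector_derivative[OF cont s])
  have "((\<lambda>s. - \<Psi> s) has_vector_derivative - (2 * (v\<^sub>1 s * v\<^sub>2 s))) (at s within {0..t})"
    by (rule has_vector_derivative_minus[OF \<Psi>'])
  then have "(exp \<circ> (\<lambda>s. - \<Psi> s) has_vector_derivative - (2 * (v\<^sub>1 s * v\<^sub>2 s)) * exp (- \<Psi> s)) (at s within {0..t})"
    by (rule field_vector_diff_chain_within) (auto intro: DERIV_subset DERIV_exp)
  then have E: "((\<lambda>s. exp (- \<Psi> s)) has_vector_derivative - (2 * (v\<^sub>1 s * v\<^sub>2 s)) * exp (- \<Psi> s)) (at s within {0..t})"
    by (simp add: o_def)
  have H: "((\<lambda>s. h\<^sub>1 s - h\<^sub>2 s) has_vector_derivative - 2 * v\<^sub>1 s - - 2 * v\<^sub>2 s) (at s within {0..t})"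
    using has_vector_derivative_diff[OF backward_flow_deriv[OF flow1 s] backward_flow_deriv[OF flow2 s]]
    by (simp add: v\<^sub>1_def v\<^sub>2_def)
  have nz: "h\<^sub>1 s - of_real (U\<^sub>1 s) \<noteq> 0" "h\<^sub>2 s - of_real (U\<^sub>2 s) \<noteq> 0"
    using backward_flow_nonzero[OF flow1 s] backward_flow_nonzero[OF flow2 s] by auto
  have "- 2 * v\<^sub>1 s - - 2 * v\<^sub>2 s = 2 * (v\<^sub>1 s * v\<^sub>2 s) * ((h\<^sub>1 s - h\<^sub>2 s) - of_real (U\<^sub>1 s - U\<^sub>2 s))"
    using nz unfolding v\<^sub>1_def v\<^sub>2_def by (simp add: field_simps)
  then show ?thesis
    using has_vector_derivative_mult[OF E H] by (simp only:) (simp add: algebra_simps)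
qed

text \<open>
  For equal driving functions the linear equation is homogeneous.  This is the finite-difference
  form of the derivative of the flow with respect to its starting point.
\<close>
lemma backward_flow_diff:
  assumes flow1: "backward_flow U t h\<^sub>1" and flow2: "backward_flow U t h\<^sub>2" and "0 \<le> t"
  shows "h\<^sub>1 t - h\<^sub>2 t = (h\<^sub>1 0 - h\<^sub>2 0) *
     exp (integral {0..t} (\<lambda>u. 2 * (1 / (h\<^sub>1 u - of_real (U u)) * (1 / (h\<^sub>2 u - of_real (U u))))))"
proof -
  let ?\<Psi> = "\<lambda>s. integral {0..s} (\<lambda>u. 2 * (1 / (h\<^sub>1 u - of_real (U u)) * (1 / (h\<^sub>2 u - of_real (U u)))))"
  obtain c where c: "\<And>s. s \<in> {0..t} \<Longrightarrow> exp (- ?\<Psi> s) * (h\<^sub>1 s - h\<^sub>2 s) = c"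
    using has_vector_derivative_zero_constant[of "{0..t}" "\<lambda>s. exp (- ?\<Psi> s) * (h\<^sub>1 s - h\<^sub>2 s)"]
      backward_flow_diff_deriv[OF flow1 flow2] by auto
  have "exp (- ?\<Psi> t) * (h\<^sub>1 t - h\<^sub>2 t) = h\<^sub>1 0 - h\<^sub>2 0"
    using c[of 0] c[of t] \<open>0 \<le> t\<close> by simp
  then show ?thesis
    by (simp add: exp_minus divide_simps mult.commute)
qed

text \<open>
  Variation of constants.  The exponent on the right is the integral of (Re v1)^2 + (Re v2)^2, since
  Re (v^2) + |v|^2 = 2 (Re v)^2; it dominates the real part of every partial integral of 2 v1 v2.
  The factor 1 + l / 2 collects the initial error and the integral of |2 v1 v2|, which is at most
  that of |v1|^2 + |v2|^2.
\<close>
lemma backward_flow_compare: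
  assumes flow1: "backward_flow U\<^sub>1 t h\<^sub>1" and flow2: "backward_flow U\<^sub>2 t h\<^sub>2" and "0 \<le> t"
    and drive: "\<And>s. s \<in> {0..t} \<Longrightarrow> \<bar>U\<^sub>1 s - U\<^sub>2 s\<bar> \<le> \<epsilon>"
    and start: "norm (h\<^sub>1 0 - h\<^sub>2 0) \<le> \<epsilon>"
  defines "v\<^sub>1 \<equiv> \<lambda>s. 1 / (h\<^sub>1 s - of_real (U\<^sub>1 s))" and "v\<^sub>2 \<equiv> \<lambda>s. 1 / (h\<^sub>2 s - of_real (U\<^sub>2 s))"
  defines "l \<equiv> ln (Im (h\<^sub>1 t) / Im (h\<^sub>1 0)) + ln (Im (h\<^sub>2 t) / Im (h\<^sub>2 0))"
  shows "norm (h\<^sub>1 t - h\<^sub>2 t) \<le>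
     \<epsilon> * exp ((Re (integral {0..t} (\<lambda>s. 2 * (v\<^sub>1 s)\<^sup>2)) + Re (integral {0..t} (\<lambda>s. 2 * (v\<^sub>2 s)\<^sup>2)) + l) / 4)
       * (1 + l / 2)"
proof -
  \<comment> \<open>A bounds the growth of the propagator exp \<open>\<Psi>\<close>, and B the accumulated forcing.\<close>
  define \<Psi> where "\<Psi> s = integral {0..s} (\<lambda>u. 2 * (v\<^sub>1 u * v\<^sub>2 u))" for s
  define I\<^sub>1 where "I\<^sub>1 s = integral {0..s} (\<lambda>u. 2 * (v\<^sub>1 u)\<^sup>2)" for s
  define I\<^sub>2 where "I\<^sub>2 s = integral {0..s} (\<lambda>u. 2 * (v\<^sub>2 u)\<^sup>2)" for s
  define B where "B s = (ln (Im (h\<^sub>1 s)) + ln (Im (h\<^sub>2 s))) / 2" for s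
  define A where "A s = (Re (I\<^sub>1 s) + Re (I\<^sub>2 s)) / 4 + (B s - B 0) / 2" for s
  have pos: "0 < Im (h\<^sub>1 s)" "0 < Im (h\<^sub>2 s)" if "s \<in> {0..t}" for s
    using flow1 flow2 that by (auto simp: backward_flow_def)
  have v_cont: "continuous_on {0..t} v\<^sub>1" "continuous_on {0..t} v\<^sub>2"
    using continuous_on_backward_flow_velocity[OF flow1] continuous_on_backward_flow_velocity[OF flow2]
    unfolding v\<^sub>1_def v\<^sub>2_def by auto
  have \<Psi>': "(\<Psi> has_vector_derivative 2 * (v\<^sub>1 s * v\<^sub>2 s)) (at s within {0..t})"
    and I\<^sub>1': "(I\<^sub>1 has_vector_derivative 2 * (v\<^sub>1 s)\<^sup>2) (at s within {0..t})"
    and I\<^sub>2': "(I\<^sub>2 has_vector_derivative 2 * (v\<^sub>2 s)\<^sup>2) (at s within {0..t})"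
    if "s \<in> {0..t}" for s
    unfolding \<Psi>_def I\<^sub>1_def I\<^sub>2_def
    by (intro integral_has_vector_derivative continuous_intros v_cont that)+
  have B': "(B has_vector_derivative (norm (v\<^sub>1 s))\<^sup>2 + (norm (v\<^sub>2 s))\<^sup>2) (at s within {0..t})"
    if "s \<in> {0..t}" for s
    using has_vector_derivative_divide[OF has_vector_derivative_add[OF
        backward_flow_ln_Im_deriv[OF flow1 that] backward_flow_ln_Im_deriv[OF flow2 that]], of 2]
    unfolding B_def v\<^sub>1_def v\<^sub>2_def by (simp add: add_divide_distrib)
  have sq: "Re (w\<^sup>2) + (norm w)\<^sup>2 = 2 * (Re w)\<^sup>2" for w :: complex
    by (simp add: cmod_power2 Re_power2)
  have avg: "(2 * a + 2 * b) / 4 + (c + d) / 2 = p + q" if "a + c = 2 * p" "b + d = 2 * q" for a b c d p q :: real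
    using that by (simp add: field_simps)
  have A': "(A has_vector_derivative (Re (v\<^sub>1 s))\<^sup>2 + (Re (v\<^sub>2 s))\<^sup>2) (at s within {0..t})"
    if s: "s \<in> {0..t}" for s
  proof -
    have "(A has_vector_derivative (Re (2 * (v\<^sub>1 s)\<^sup>2) + Re (2 * (v\<^sub>2 s)\<^sup>2)) / 4
            + ((norm (v\<^sub>1 s))\<^sup>2 + (norm (v\<^sub>2 s))\<^sup>2) / 2) (at s within {0..t})"
      unfolding A_def
      by (intro has_vector_derivative_add has_vector_derivative_divide has_vector_derivative_diff_const
          bounded_linear.has_vector_derivative[OF bounded_linear_Re] I\<^sub>1'[OF s] I\<^sub>2'[OF s] B'[OF s]
          B'[OF s, THEN has_vector_derivative_diff_const[THEN iffD2]])
    moreover have "(Re (2 * (v\<^sub>1 s)\<^sup>2) + Re (2 * (v\<^sub>2 s)\<^sup>2)) / 4 + ((norm (v\<^sub>1 s))\<^sup>2 + (norm (v\<^sub>2 s))\<^sup>2) / 2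
        = (Re (v\<^sub>1 s))\<^sup>2 + (Re (v\<^sub>2 s))\<^sup>2"
      using sq[of "v\<^sub>1 s"] sq[of "v\<^sub>2 s"] avg by simp
    ultimately show ?thesis
      by metis
  qed
  have Re_\<psi>_le: "Re (2 * (v\<^sub>1 s * v\<^sub>2 s)) \<le> (Re (v\<^sub>1 s))\<^sup>2 + (Re (v\<^sub>2 s))\<^sup>2" if "s \<in> {0..t}" for s
  proof -
    have "0 < Im (v\<^sub>1 s) * Im (v\<^sub>2 s)"
      using backward_flow_Im_velocity_neg[OF flow1 that] backward_flow_Im_velocity_neg[OF flow2 that]
      unfolding v\<^sub>1_def v\<^sub>2_def by (intro mult_neg_neg)
    moreover have "2 * (Re (v\<^sub>1 s) * Re (v\<^sub>2 s)) \<le> (Re (v\<^sub>1 s))\<^sup>2 + (Re (v\<^sub>2 s))\<^sup>2"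
      using sum_squares_bound[of "Re (v\<^sub>1 s)" "Re (v\<^sub>2 s)"] by simp
    ultimately show ?thesis
      by simp
  qed
  \<comment> \<open>Both A - Re \<open>\<Psi>\<close> and A increase from 0, so A t bounds the increment of Re \<open>\<Psi>\<close>
    over every final interval.\<close>
  have tail: "Re (\<Psi> t) - Re (\<Psi> s) \<le> A t" if s: "s \<in> {0..t}" for s
  proof -
    have "norm ((0::real) - 0) \<le> (A t - Re (\<Psi> t)) - (A s - Re (\<Psi> s))"
    proof (rule norm_increment_le[where f = "\<lambda>_. 0::real" and f' = "\<lambda>_. 0" and \<phi> = "\<lambda>s. A s - Re (\<Psi> s)"])
      fix u assume u: "u \<in> {s..t}"
      then have ut: "u \<in> {0..t}" and sub: "{s..t} \<subseteq> {0..t}"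
        using s by auto
      show "((\<lambda>s. A s - Re (\<Psi> s)) has_vector_derivative
          ((Re (v\<^sub>1 u))\<^sup>2 + (Re (v\<^sub>2 u))\<^sup>2) - Re (2 * (v\<^sub>1 u * v\<^sub>2 u))) (at u within {s..t})"
        by (intro has_vector_derivative_within_subset[OF _ sub] has_vector_derivative_diff A'[OF ut]
            bounded_linear.has_vector_derivative[OF bounded_linear_Re \<Psi>'[OF ut]])
      show "norm (0::real) \<le> ((Re (v\<^sub>1 u))\<^sup>2 + (Re (v\<^sub>2 u))\<^sup>2) - Re (2 * (v\<^sub>1 u * v\<^sub>2 u))"
        using Re_\<psi>_le[OF ut] by simp
    qed (use s in auto)
    moreover have "norm ((0::real) - 0) \<le> A s - A 0"
    proof (rule norm_increment_le[where f = "\<lambda>_. 0::real" and f' = "\<lambda>_. 0" and \<phi> = A])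
      fix u assume u: "u \<in> {0..s}"
      then have ut: "u \<in> {0..t}" and sub: "{0..s} \<subseteq> {0..t}"
        using s by auto
      show "(A has_vector_derivative (Re (v\<^sub>1 u))\<^sup>2 + (Re (v\<^sub>2 u))\<^sup>2) (at u within {0..s})"
        by (rule has_vector_derivative_within_subset[OF A'[OF ut] sub])
    qed (use s in auto)
    moreover have "A 0 = 0"
      by (simp add: A_def I\<^sub>1_def I\<^sub>2_def)
    ultimately show ?thesis
      by simp
  qed
  have eps: "0 \<le> \<epsilon>"
    using start norm_ge_zero order_trans by blast
  have "norm (exp (\<Psi> t) * (exp (- \<Psi> t) * (h\<^sub>1 t - h\<^sub>2 t)) - exp (\<Psi> t) * (exp (- \<Psi> 0) * (h\<^sub>1 0 - h\<^sub>2 0)))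
      \<le> \<epsilon> * exp (A t) * B t - \<epsilon> * exp (A t) * B 0"
  proof (rule norm_increment_le[where f = "\<lambda>s. exp (\<Psi> t) * (exp (- \<Psi> s) * (h\<^sub>1 s - h\<^sub>2 s))"
        and \<phi> = "\<lambda>s. \<epsilon> * exp (A t) * B s"])
    fix s assume s: "s \<in> {0..t}"
    let ?D = "exp (\<Psi> t) * (- exp (- \<Psi> s) * (2 * (v\<^sub>1 s * v\<^sub>2 s)) * of_real (U\<^sub>1 s - U\<^sub>2 s))"
    show "((\<lambda>s. exp (\<Psi> t) * (exp (- \<Psi> s) * (h\<^sub>1 s - h\<^sub>2 s))) has_vector_derivative ?D) (at s within {0..t})"
      using backward_flow_diff_deriv[OF flow1 flow2 s]
      unfolding \<Psi>_def v\<^sub>1_def v\<^sub>2_def by (intro has_vector_derivative_mult_right)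
    show "((\<lambda>s. \<epsilon> * exp (A t) * B s) has_vector_derivative
        \<epsilon> * exp (A t) * ((norm (v\<^sub>1 s))\<^sup>2 + (norm (v\<^sub>2 s))\<^sup>2)) (at s within {0..t})"
      by (rule has_vector_derivative_mult_right[OF B'[OF s]])
    have "norm ?D = \<bar>U\<^sub>1 s - U\<^sub>2 s\<bar> * exp (Re (\<Psi> t) - Re (\<Psi> s)) * (2 * norm (v\<^sub>1 s) * norm (v\<^sub>2 s))"
      by (simp add: norm_mult norm_divide exp_diff exp_minus field_simps del: of_real_diff)
    also have "\<dots> \<le> \<epsilon> * exp (A t) * ((norm (v\<^sub>1 s))\<^sup>2 + (norm (v\<^sub>2 s))\<^sup>2)"
      using drive[OF s] tail[OF s] eps sum_squares_bound[of "norm (v\<^sub>1 s)" "norm (v\<^sub>2 s)"]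
      by (intro mult_mono) auto
    finally show "norm ?D \<le> \<epsilon> * exp (A t) * ((norm (v\<^sub>1 s))\<^sup>2 + (norm (v\<^sub>2 s))\<^sup>2)" .
  qed (use \<open>0 \<le> t\<close> in auto)
  moreover have "exp (\<Psi> t) * (exp (- \<Psi> t) * (h\<^sub>1 t - h\<^sub>2 t)) = h\<^sub>1 t - h\<^sub>2 t"
    by (simp add: exp_minus)
  moreover have "exp (- \<Psi> 0) * (h\<^sub>1 0 - h\<^sub>2 0) = h\<^sub>1 0 - h\<^sub>2 0"
    by (simp add: \<Psi>_def)
  ultimately have incr: "norm ((h\<^sub>1 t - h\<^sub>2 t) - exp (\<Psi> t) * (h\<^sub>1 0 - h\<^sub>2 0)) \<le> \<epsilon> * exp (A t) * (B t - B 0)"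
    by (simp only: right_diff_distrib[of "\<epsilon> * exp (A t)"])
  have init: "norm (exp (\<Psi> t) * (h\<^sub>1 0 - h\<^sub>2 0)) \<le> exp (A t) * \<epsilon>"
    using tail[of 0] \<open>0 \<le> t\<close> start unfolding norm_mult
    by (intro mult_mono) (auto simp: \<Psi>_def)
  have l: "l = 2 * (B t - B 0)"
    using pos[of 0] pos[of t] \<open>0 \<le> t\<close> by (simp add: l_def B_def ln_div field_simps)
  have "norm (h\<^sub>1 t - h\<^sub>2 t) \<le> \<epsilon> * exp (A t) * (1 + (B t - B 0))"
    using norm_triangle_sub[of "h\<^sub>1 t - h\<^sub>2 t" "exp (\<Psi> t) * (h\<^sub>1 0 - h\<^sub>2 0)"] incr init
    by (simp add: algebra_simps)
  moreover have "A t = (Re (I\<^sub>1 t) + Re (I\<^sub>2 t) + l) / 4" "1 + (B t - B 0) = 1 + l / 2"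
    by (simp_all add: l A_def field_simps)
  ultimately show ?thesis
    by (simp only: I\<^sub>1_def I\<^sub>2_def)
qed

section \<open>Constancy along characteristics\<close>

text \<open>
  By compactness f s is uniformly close to f t near z when s is close to t; Cauchy's inequality
  transfers this to the derivatives.
\<close>
lemma continuous_deriv_param:
  fixes f :: "real \<Rightarrow> complex \<Rightarrow> complex"
  assumes cont: "continuous_on (T \<times> S) (\<lambda>(s, z). f s z)" and S: "open S"
    and hol: "\<And>s. s \<in> T \<Longrightarrow> f s holomorphic_on S"
    and t: "t \<in> T" and z: "z \<in> S"
  shows "continuous (at (t, z) within T \<times> S) (\<lambda>(s, w). deriv (f s) w)"
proof -
  obtain r where r: "0 < r" "cball z (2 * r) \<subseteq> S"
  proof -
    obtain e where "0 < e" "cball z e \<subseteq> S"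
      using S z open_contains_cball by blast
    then show ?thesis
      using that[of "e / 2"] by simp
  qed
  show ?thesis
    unfolding continuous_within
  proof (rule tendstoI)
    fix e :: real assume "0 < e"
    have "continuous_on (T \<times> cball z (2 * r)) (\<lambda>(s, z). f s z)"
      using r by (intro continuous_on_subset[OF cont]) auto
    then obtain X where X: "t \<in> X" "open X"
      "\<forall>s\<in>X \<inter> T. \<forall>w\<in>cball z (2 * r). dist (f s w) (f t w) \<le> e * r / 2"
      using continuous_on_prod_compactE[of T "cball z (2 * r)" "\<lambda>(s, z). f s z" t "e * r / 2"] \<open>0 < e\<close> r t
      by auto
    then obtain \<delta>\<^sub>2 where \<delta>\<^sub>2: "0 < \<delta>\<^sub>2"
      "\<And>s w. \<lbrakk>s \<in> T; dist s t < \<delta>\<^sub>2; w \<in> cball z (2 * r)\<rbrakk> \<Longrightarrow> dist (f s w) (f t w) \<le> e * r / 2"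
      by (meson IntI open_dist)
    have "isCont (deriv (f t)) z"
      using holomorphic_deriv[OF hol[OF t] S] S z
      by (metis continuous_on_eq_continuous_at holomorphic_on_imp_continuous_on)
    then have "\<forall>\<^sub>F w in nhds z. dist (deriv (f t) w) (deriv (f t) z) < e / 2"
      using \<open>0 < e\<close> by (intro tendstoD) (auto simp: isCont_def tendsto_at_iff_tendsto_nhds)
    then obtain \<delta>\<^sub>1 where \<delta>\<^sub>1: "0 < \<delta>\<^sub>1" "\<And>w. dist w z < \<delta>\<^sub>1 \<Longrightarrow> dist (deriv (f t) w) (deriv (f t) z) < e / 2"
      unfolding eventually_nhds_metric by auto
    define \<delta> where "\<delta> = min r (min \<delta>\<^sub>1 \<delta>\<^sub>2)"
    have main: "dist (deriv (f s) w) (deriv (f t) z) < e"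
      if s: "s \<in> T" and dist: "dist (s, w) (t, z) < \<delta>" for s w
    proof -
      have st: "dist s t < \<delta>" and wz: "dist w z < \<delta>"
        using dist dist_fst_le[of "(s, w)" "(t, z)"] dist_snd_le[of "(s, w)" "(t, z)"] by auto
      have sub: "cball w r \<subseteq> cball z (2 * r)"
      proof
        fix x assume "x \<in> cball w r"
        then show "x \<in> cball z (2 * r)"
          using wz dist_triangle[of z x w] by (auto simp: \<delta>_def dist_commute)
      qed
      have holD: "(\<lambda>x. f s x - f t x) holomorphic_on S"
        by (intro holomorphic_intros hol s t)
      have w: "w \<in> S"
        using sub r(1) by (intro subsetD[OF r(2)] subsetD[OF sub]) auto
      have "norm ((deriv ^^ 1) (\<lambda>x. f s x - f t x) w) \<le> fact 1 * (e * r / 2) / r ^ 1"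
      proof (rule Cauchy_inequality)
        show "(\<lambda>x. f s x - f t x) holomorphic_on ball w r"
          using sub r ball_subset_cball by (intro holomorphic_on_subset[OF holD]) blast
        show "continuous_on (cball w r) (\<lambda>x. f s x - f t x)"
          using sub r by (intro holomorphic_on_imp_continuous_on holomorphic_on_subset[OF holD]) blast
        show "norm (f s x - f t x) \<le> e * r / 2" if "norm (w - x) = r" for x
        proof -
          have "x \<in> cball z (2 * r)"
            using sub that by (auto simp: dist_norm)
          then show ?thesis
            using \<delta>\<^sub>2(2)[OF s _ ] st by (auto simp: dist_norm \<delta>_def)
        qed
      qed (use r in auto)
      moreover have "deriv (\<lambda>x. f s x - f t x) w = deriv (f s) w - deriv (f t) w"
        by (intro deriv_diff holomorphic_on_imp_differentiable_at[OF hol S] s t w)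
      ultimately have "dist (deriv (f s) w) (deriv (f t) w) \<le> e / 2"
        using r by (simp add: dist_norm)
      moreover have "dist (deriv (f t) w) (deriv (f t) z) < e / 2"
        using \<delta>\<^sub>1(2) wz by (simp add: \<delta>_def)
      ultimately show ?thesis
        using dist_triangle_half_l[of "deriv (f s) w" "deriv (f t) w"] dist_triangle[of "deriv (f s) w" "deriv (f t) z" "deriv (f t) w"]
        by linarith
    qed
    have "0 < \<delta>"
      using r \<delta>\<^sub>1 \<delta>\<^sub>2 by (simp add: \<delta>_def)
    then show "\<forall>\<^sub>F x in at (t, z) within T \<times> S. dist ((\<lambda>(s, w). deriv (f s) w) x) ((\<lambda>(s, w). deriv (f s) w) (t, z)) < e"
      unfolding eventually_at using main by (intro exI[of _ \<delta>]) auto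
  qed
qed

text \<open>
  The Loewner equation says that the map s \<mapsto> f (t - s) (h s) has derivative zero; its values at
  the two ends are f t (h 0) and f 0 (h t) = h t.
\<close>
lemma loewner_backward_flow:
  assumes pair: "loewner_pair f W" and "0 \<le> t" and flow: "backward_flow (\<lambda>s. W (t - s)) t h"
  shows "f t (h 0) = h t"
proof -
  let ?H = upper_half_plane
  have cont: "continuous_on ({0..} \<times> ?H) (\<lambda>(t, z). f t z)"
    and hol: "\<And>s. 0 \<le> s \<Longrightarrow> f s holomorphic_on ?H"
    and init: "\<And>z. z \<in> ?H \<Longrightarrow> f 0 z = z"
    and pde: "\<And>s z. 0 \<le> s \<Longrightarrow> z \<in> ?H \<Longrightarrow> ((\<lambda>s. f s z) has_vector_derivative
           - deriv (f s) z * (2 / (z - of_real (W s)))) (at s within {0..})"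
    using pair by (auto simp: loewner_pair_def)
  have H: "open ?H" "convex ?H"
    using open_halfspace_Im_gt[of 0] convex_halfspace_Im_gt[of 0] by (auto simp: upper_half_plane_def)
  have "((\<lambda>s. f (t - s) (h s)) has_vector_derivative 0) (at s within {0..t})" if s: "s \<in> {0..t}" for s
  proof -
    let ?\<tau> = "t - s" and ?D = "\<lambda>s z. deriv (f s) z"
    have hs: "h s \<in> ?H"
      using flow s by (auto simp: backward_flow_def upper_half_plane_def)
    \<comment> \<open>Joint differentiability, one-sided in time because of the end point at time 0.\<close>
    have joint: "((\<lambda>(s, z). f s z) has_derivative
        (\<lambda>(ds, dz). ds *\<^sub>R (- ?D ?\<tau> (h s) * (2 / (h s - of_real (W ?\<tau>)))) + blinfun_mult_right (?D ?\<tau> (h s)) dz))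
        (at (?\<tau>, h s) within {0..} \<times> ?H)"
    proof (rule has_derivative_partialsI)
      show "((\<lambda>s'. f s' (h s)) has_derivative
          (\<lambda>ds. ds *\<^sub>R (- ?D ?\<tau> (h s) * (2 / (h s - of_real (W ?\<tau>)))))) (at ?\<tau> within {0..})"
        using pde[of ?\<tau> "h s"] s hs by (simp add: has_vector_derivative_def)
      show "((\<lambda>z. f s' z) has_derivative blinfun_apply (blinfun_mult_right (?D s' z))) (at z within ?H)"
        if "s' \<in> {0..}" "z \<in> ?H" for s' z
        using holomorphic_derivI[OF hol[of s'] H(1) that(2)] that
        by (auto simp: has_field_derivative_def intro: has_derivative_at_withinI)
      show "continuous (at (?\<tau>, h s) within {0..} \<times> ?H) (\<lambda>(s, z). blinfun_mult_right (?D s z))"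
        using bounded_linear.continuous[OF bounded_linear_blinfun_mult_right
            continuous_deriv_param[OF cont H(1) hol, of ?\<tau> "h s"]] s hs
        by (simp add: case_prod_unfold)
    qed (use hs H in auto)
    have h': "(h has_vector_derivative - (2 / (h s - of_real (W ?\<tau>)))) (at s within {0..t})"
      using flow s by (auto simp: backward_flow_def)
    have path: "((\<lambda>s. (t - s, h s)) has_derivative (\<lambda>x. (- x, x *\<^sub>R - (2 / (h s - of_real (W ?\<tau>)))))) (at s within {0..t})"
      using h' unfolding has_vector_derivative_def
      by (auto intro!: derivative_eq_intros has_derivative_Pair)
    have img: "(\<lambda>s. (t - s, h s)) ` {0..t} \<subseteq> {0..} \<times> ?H"
      using flow by (auto simp: backward_flow_def upper_half_plane_def)
    show ?thesis
      using has_derivative_in_compose[OF path has_derivative_subset[OF joint img]]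
      by (simp add: has_vector_derivative_def scaleR_conv_of_real)
  qed
  then obtain c where "\<And>s. s \<in> {0..t} \<Longrightarrow> f (t - s) (h s) = c"
    using has_vector_derivative_zero_constant[of "{0..t}" "\<lambda>s. f (t - s) (h s)"] by auto
  from this[of 0] this[of t] have "f t (h 0) = f 0 (h t)"
    using \<open>0 \<le> t\<close> by simp
  moreover have "h t \<in> ?H"
    using flow \<open>0 \<le> t\<close> by (auto simp: backward_flow_def upper_half_plane_def)
  ultimately show ?thesis
    using init by simp
qed

text \<open>
  The difference quotient of f t at z is, by backward_flow_diff, the exponential of the integral of
  2 v_w v_z over two neighbouring flows, where v_w belongs to the flow started at w.  As w tends to
  z the integrand converges uniformly to 2 v_z^2, because neighbouring flows stay together.
\<close>
lemma loewner_deriv: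
  assumes pair: "loewner_pair f W" and "0 \<le> t" and flow: "backward_flow (\<lambda>s. W (t - s)) t h"
  shows "deriv (f t) (h 0) = exp (integral {0..t} (\<lambda>s. 2 * (1 / (h s - of_real (W (t - s))))\<^sup>2))"
proof -
  define U where "U s = W (t - s)" for s
  define z where "z = h 0"
  \<comment> \<open>Flows started within y of z start, and hence stay, at height at least y.\<close>
  define y where "y = Im z / 2"
  define v where "v g s = 1 / (g s - of_real (U s))" for g :: "real \<Rightarrow> complex" and s
  have flow: "backward_flow U t h"
    using assms by (simp add: U_def[abs_def])
  have U_cont: "continuous_on {0..t} U"
    using flow by (simp add: backward_flow_def)
  have y: "0 < y"
    using flow \<open>0 \<le> t\<close> by (auto simp: y_def z_def backward_flow_def)
  have "\<forall>w. \<exists>g. 0 < Im w \<longrightarrow> backward_flow U t g \<and> g 0 = w"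
    using backward_flow_exists[OF \<open>0 \<le> t\<close> U_cont] by metis
  then obtain g where g: "\<And>w. 0 < Im w \<Longrightarrow> backward_flow U t (g w)" "\<And>w. 0 < Im w \<Longrightarrow> g w 0 = w"
    by metis
  have f_eq: "f t w = g w t" if "0 < Im w" for w
    using loewner_backward_flow[OF pair \<open>0 \<le> t\<close>, of "g w"] g[OF that] by (simp add: U_def[abs_def])
  have f_z: "f t z = h t"
    using loewner_backward_flow[OF pair \<open>0 \<le> t\<close>, of h] flow by (simp add: U_def[abs_def] z_def)
  define I where "I w = integral {0..t} (\<lambda>s. 2 * (v (g w) s * v h s))" for w
  define I\<^sub>0 where "I\<^sub>0 = integral {0..t} (\<lambda>s. 2 * (v h s)\<^sup>2)"
  have near: "0 < Im w \<and> (\<forall>s\<in>{0..t}. norm (v (g w) s) \<le> 1 / y \<and> norm (v h s) \<le> 1 / y)"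
    if "dist w z < y" for w
  proof -
    have "Im z - Im w < y"
      using that abs_Im_le_cmod[of "z - w"] by (auto simp: dist_norm norm_minus_commute)
    then have w: "y \<le> Im w"
      by (simp add: y_def)
    have "norm (v (g w) s) \<le> 1 / y \<and> norm (v h s) \<le> 1 / y" if s: "s \<in> {0..t}" for s
    proof -
      have "norm (v (g w) s) \<le> 1 / Im w"
        using backward_flow_velocity_le[OF g(1) s, of w] g(2)[of w] w y by (simp add: v_def)
      moreover have "norm (v h s) \<le> 1 / Im z"
        using backward_flow_velocity_le[OF flow s] by (simp add: v_def z_def)
      moreover have "y \<le> Im z"
        using y by (simp add: y_def)
      then have "1 / Im w \<le> 1 / y" "1 / Im z \<le> 1 / y"
        using w y by (simp_all add: frac_le)
      ultimately show ?thesis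
        by linarith
    qed
    then show ?thesis
      using w y by auto
  qed
  have v_cont: "continuous_on {0..t} (v k)" if "backward_flow U t k" for k
    using continuous_on_backward_flow_velocity[OF that] by (simp add: v_def[abs_def])
  have diff: "g w s - h s = (w - z) * exp (integral {0..s} (\<lambda>u. 2 * (v (g w) u * v h u)))"
    if w: "0 < Im w" and s: "s \<in> {0..t}" for w s
    using backward_flow_diff[of U s "g w" h] backward_flow_restrict[OF g(1)[OF w], of s]
      backward_flow_restrict[OF flow, of s] s g(2)[OF w] by (simp add: v_def z_def)
  have alg: "2 * (1 / a * (1 / b)) - 2 * (1 / b)\<^sup>2 = - 2 * (1 / a * (1 / b) * (1 / b) * (a - b))"
    if "a \<noteq> 0" "b \<noteq> 0" for a b :: complex
    using that by (simp add: field_simps power2_eq_square)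
  define C where "C = exp (2 / y\<^sup>2 * t)"
  have I_close: "dist (I w) I\<^sub>0 \<le> (2 / y ^ 3 * C * t) * dist w z" if w: "dist w z < y" for w
  proof -
    note w' = near[OF w]
    have drift: "norm (g w s - h s) \<le> dist w z * C" if s: "s \<in> {0..t}" for s
    proof -
      have sub: "{0..s} \<subseteq> {0..t}"
        using s by auto
      have "norm (integral {0..s} (\<lambda>u. 2 * (v (g w) u * v h u))) \<le> 2 / y\<^sup>2 * (s - 0)"
      proof (rule integral_bound)
        show "continuous_on {0..s} (\<lambda>u. 2 * (v (g w) u * v h u))"
          using w' by (intro continuous_on_subset[OF _ sub] continuous_on_mult continuous_on_const v_cont g(1) flow) auto
        show "\<And>u. u \<in> {0..s} \<Longrightarrow> norm (2 * (v (g w) u * v h u)) \<le> 2 / y\<^sup>2"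
        proof -
          fix u assume "u \<in> {0..s}"
          then have "norm (v (g w) u) * norm (v h u) \<le> (1 / y) * (1 / y)"
            using w' s y by (intro mult_mono) auto
          then show "norm (2 * (v (g w) u * v h u)) \<le> 2 / y\<^sup>2"
            by (simp add: norm_mult power2_eq_square)
        qed
      qed (use s in auto)
      also have "\<dots> \<le> 2 / y\<^sup>2 * t"
        using s y by (intro mult_left_mono) auto
      finally have "norm (exp (integral {0..s} (\<lambda>u. 2 * (v (g w) u * v h u)))) \<le> C"
        unfolding C_def by (meson exp_le_cancel_iff norm_exp order_trans)
      then show ?thesis
        unfolding diff[OF conjunct1[OF w'] s] norm_mult dist_norm by (intro mult_left_mono) auto
    qed
    have "I w - I\<^sub>0 = integral {0..t} (\<lambda>s. 2 * (v (g w) s * v h s) - 2 * (v h s)\<^sup>2)"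
      unfolding I_def I\<^sub>0_def using w'
      by (intro integral_diff[symmetric] integrable_continuous_real continuous_on_mult continuous_on_const
          continuous_on_power v_cont g(1) flow) auto
    also have "norm \<dots> \<le> (2 / y ^ 3 * C * dist w z) * (t - 0)"
    proof (rule integral_bound)
      show "continuous_on {0..t} (\<lambda>s. 2 * (v (g w) s * v h s) - 2 * (v h s)\<^sup>2)"
        using w' by (intro continuous_on_diff continuous_on_mult continuous_on_const
          continuous_on_power v_cont g(1) flow) auto
      fix s assume s: "s \<in> {0..t}"
      have nz: "g w s - of_real (U s) \<noteq> 0" "h s - of_real (U s) \<noteq> 0"
        using backward_flow_nonzero[OF g(1) s] backward_flow_nonzero[OF flow s] w' by auto
      have "2 * (v (g w) s * v h s) - 2 * (v h s)\<^sup>2 = - 2 * (v (g w) s * v h s * v h s * (g w s - h s))"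
        using alg[OF nz] by (simp add: v_def)
      then have "norm (2 * (v (g w) s * v h s) - 2 * (v h s)\<^sup>2)
          = 2 * (norm (v (g w) s) * norm (v h s) * norm (v h s) * norm (g w s - h s))"
        by (simp only: norm_mult norm_minus_cancel norm_numeral)
      also have "\<dots> \<le> 2 * (1 / y * (1 / y) * (1 / y) * (dist w z * C))"
        using w' s y drift[OF s] by (intro mult_left_mono mult_mono) auto
      finally show "norm (2 * (v (g w) s * v h s) - 2 * (v h s)\<^sup>2) \<le> 2 / y ^ 3 * C * dist w z"
        using y by (simp add: power3_eq_cube mult_ac)
    qed (use \<open>0 \<le> t\<close> in auto)
    finally show ?thesis
      by (simp add: dist_norm mult_ac)
  qed
  have ev: "\<forall>\<^sub>F w in at z. dist w z < y"
    using y by (auto simp: eventually_at)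
  have "((\<lambda>w. (2 / y ^ 3 * C * t) * dist w z) \<longlongrightarrow> 0) (at z)"
    by (rule tendsto_mult_right_zero, rule tendsto_dist_iff[THEN iffD1], rule tendsto_ident_at)
  moreover have "\<forall>\<^sub>F w in at z. norm (I w - I\<^sub>0) \<le> (2 / y ^ 3 * C * t) * dist w z"
    using ev by (rule eventually_mono) (use I_close in \<open>simp only: dist_norm\<close>)
  ultimately have "((\<lambda>w. I w - I\<^sub>0) \<longlongrightarrow> 0) (at z)"
    by (rule Lim_null_comparison[rotated])
  then have "(I \<longlongrightarrow> I\<^sub>0) (at z)"
    by (rule LIM_zero_cancel)
  then have "((\<lambda>w. exp (I w)) \<longlongrightarrow> exp I\<^sub>0) (at z)"
    by (intro tendsto_intros)
  moreover have "\<forall>\<^sub>F w in at z. exp (I w) = (f t w - f t z) / (w - z)"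
  proof -
    have "\<forall>\<^sub>F w in at z. w \<noteq> z"
      by (simp add: eventually_at_filter)
    with ev show ?thesis
    proof eventually_elim
      case (elim w)
      then show ?case
        using diff[of w t] near[of w] f_eq[of w] f_z \<open>0 \<le> t\<close> by (simp add: I_def)
    qed
  qed
  ultimately have "((\<lambda>w. (f t w - f t z) / (w - z)) \<longlongrightarrow> exp I\<^sub>0) (at z)"
    by (rule Lim_transform_eventually)
  then have "(f t has_field_derivative exp I\<^sub>0) (at z)"
    by (simp add: has_field_derivative_iff)
  then show ?thesis
    by (simp add: DERIV_imp_deriv I\<^sub>0_def v_def z_def U_def)
qed

section \<open>Comparison of two Loewner chains near their driving points\<close>

text \<open>
  The parameter R is a common bound for the factors by which the height of a flow started at height
  d can grow up to time t; these are at most sqrt (4 t + d^2) / d because (Im h)^2 grows at rate at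
  most 4.
\<close>
lemma loewner_compare:
  assumes pair1: "loewner_pair f\<^sub>1 W\<^sub>1" and pair2: "loewner_pair f\<^sub>2 W\<^sub>2" and "0 \<le> t" "0 < d"
    and drive: "\<And>s. s \<in> {0..t} \<Longrightarrow> \<bar>W\<^sub>1 s - W\<^sub>2 s\<bar> \<le> \<epsilon>"
  defines "z\<^sub>1 \<equiv> of_real (W\<^sub>1 t) + \<i> * of_real d" and "z\<^sub>2 \<equiv> of_real (W\<^sub>2 t) + \<i> * of_real d"
  assumes D1: "cmod (deriv (f\<^sub>1 t) z\<^sub>1) \<le> D" and D2: "cmod (deriv (f\<^sub>2 t) z\<^sub>2) \<le> D"
    and R: "sqrt (4 * t + d\<^sup>2) / d \<le> R"
  shows "cmod (f\<^sub>1 t z\<^sub>1 - f\<^sub>2 t z\<^sub>2) \<le> \<epsilon> * sqrt (D * R) * (1 + ln R)"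
proof -
  have U_cont: "continuous_on {0..t} (\<lambda>s. W (t - s))" if "loewner_pair f W" for f W
    using that by (auto simp: loewner_pair_def intro!: continuous_on_compose2[of "{0..}" W] continuous_intros)
  obtain h\<^sub>1 where h1: "backward_flow (\<lambda>s. W\<^sub>1 (t - s)) t h\<^sub>1" "h\<^sub>1 0 = z\<^sub>1"
    using backward_flow_exists[OF \<open>0 \<le> t\<close> U_cont[OF pair1], of z\<^sub>1] \<open>0 < d\<close> by (auto simp: z\<^sub>1_def)
  obtain h\<^sub>2 where h2: "backward_flow (\<lambda>s. W\<^sub>2 (t - s)) t h\<^sub>2" "h\<^sub>2 0 = z\<^sub>2"
    using backward_flow_exists[OF \<open>0 \<le> t\<close> U_cont[OF pair2], of z\<^sub>2] \<open>0 < d\<close> by (auto simp: z\<^sub>2_def)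
  have Im_z: "Im z\<^sub>1 = d" "Im z\<^sub>2 = d"
    by (simp_all add: z\<^sub>1_def z\<^sub>2_def)
  have f_eq: "f\<^sub>1 t z\<^sub>1 = h\<^sub>1 t" "f\<^sub>2 t z\<^sub>2 = h\<^sub>2 t"
    using loewner_backward_flow[OF pair1 \<open>0 \<le> t\<close> h1(1)] loewner_backward_flow[OF pair2 \<open>0 \<le> t\<close> h2(1)] h1 h2
    by simp_all
  define L\<^sub>1 where "L\<^sub>1 = integral {0..t} (\<lambda>s. 2 * (1 / (h\<^sub>1 s - of_real (W\<^sub>1 (t - s))))\<^sup>2)"
  define L\<^sub>2 where "L\<^sub>2 = integral {0..t} (\<lambda>s. 2 * (1 / (h\<^sub>2 s - of_real (W\<^sub>2 (t - s))))\<^sup>2)"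
  have "exp (Re L\<^sub>1) \<le> D" "exp (Re L\<^sub>2) \<le> D"
    using D1 D2 loewner_deriv[OF pair1 \<open>0 \<le> t\<close> h1(1)] loewner_deriv[OF pair2 \<open>0 \<le> t\<close> h2(1)]
    by (simp_all add: h1 h2 L\<^sub>1_def L\<^sub>2_def)
  moreover from this have "0 < D"
    using exp_gt_zero less_le_trans by blast
  ultimately have L: "Re L\<^sub>1 \<le> ln D" "Re L\<^sub>2 \<le> ln D"
    by (simp_all add: ln_ge_iff)
  have ratio: "Im (h t) / d \<le> R \<and> 1 \<le> Im (h t) / d"
    if flow: "backward_flow U t h" and "Im (h 0) = d" for U h
  proof -
    have "(Im (h t))\<^sup>2 \<le> 4 * t + d\<^sup>2" "d \<le> Im (h t)"
      using backward_flow_Im_growth[OF flow, of t] backward_flow_Im_increasing[OF flow, of t] \<open>0 \<le> t\<close> that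
      by auto
    then have "Im (h t) \<le> sqrt (4 * t + d\<^sup>2)"
      by (simp add: real_le_rsqrt)
    then have "Im (h t) / d \<le> sqrt (4 * t + d\<^sup>2) / d"
      using \<open>0 < d\<close> by (simp add: divide_right_mono)
    then show ?thesis
      using R \<open>d \<le> Im (h t)\<close> \<open>0 < d\<close> by simp
  qed
  have r1: "Im (h\<^sub>1 t) / d \<le> R" "1 \<le> Im (h\<^sub>1 t) / d" and r2: "Im (h\<^sub>2 t) / d \<le> R" "1 \<le> Im (h\<^sub>2 t) / d"
    using ratio[OF h1(1)] ratio[OF h2(1)] by (simp_all add: h1 h2 Im_z)
  have "1 \<le> R"
    using r1 by linarith
  define l where "l = ln (Im (h\<^sub>1 t) / d) + ln (Im (h\<^sub>2 t) / d)"
  have "0 \<le> l"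
    unfolding l_def using r1(2) r2(2) by (intro add_nonneg_nonneg ln_ge_zero)
  have "ln (Im (h\<^sub>1 t) / d) \<le> ln R" "ln (Im (h\<^sub>2 t) / d) \<le> ln R"
    using r1 r2 by (intro ln_mono; linarith)+
  then have l: "l \<le> 2 * ln R"
    by (simp add: l_def)
  have eps: "0 \<le> \<epsilon>"
    using drive[of 0] \<open>0 \<le> t\<close> by auto
  have "norm (h\<^sub>1 t - h\<^sub>2 t) \<le> \<epsilon> * exp ((Re L\<^sub>1 + Re L\<^sub>2 + l) / 4) * (1 + l / 2)"
  proof -
    have "norm (h\<^sub>1 0 - h\<^sub>2 0) \<le> \<epsilon>"
      using drive[of t] \<open>0 \<le> t\<close> by (simp add: h1 h2 z\<^sub>1_def z\<^sub>2_def flip: of_real_diff)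
    moreover have "\<bar>W\<^sub>1 (t - s) - W\<^sub>2 (t - s)\<bar> \<le> \<epsilon>" if "s \<in> {0..t}" for s
      using drive[of "t - s"] that by auto
    ultimately show ?thesis
      using backward_flow_compare[OF h1(1) h2(1) \<open>0 \<le> t\<close>, of \<epsilon>]
      by (simp add: L\<^sub>1_def L\<^sub>2_def l_def h1(2) h2(2) Im_z)
  qed
  also have "\<dots> \<le> \<epsilon> * exp ((2 * ln D + 2 * ln R) / 4) * (1 + ln R)"
    using L l eps \<open>0 \<le> l\<close> by (intro mult_mono) auto
  also have "exp ((2 * ln D + 2 * ln R) / 4) = sqrt (D * R)"
  proof -
    have "(2 * ln D + 2 * ln R) / 4 = ln (D * R) / 2"
      using \<open>0 < D\<close> \<open>1 \<le> R\<close> by (simp add: ln_mult field_simps)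
    then show ?thesis
      using \<open>0 < D\<close> \<open>1 \<le> R\<close> by (simp add: powr_half_sqrt[symmetric] powr_def)
  qed
  finally show ?thesis
    by (simp add: f_eq)
qed

text \<open>
  The hypothesis bounds the derivative along the vertical segment by c y^(-\<beta>), which is integrable
  at 0 since \<beta> < 1.
\<close>
lemma vertical_limit_distance:
  fixes g :: "complex \<Rightarrow> complex" and x \<beta> c d :: real
  assumes hol: "g holomorphic_on {z. 0 < Im z}" and "0 < d" "\<beta> < 1" "0 \<le> c"
    and lim: "((\<lambda>y. g (of_real x + \<i> * of_real y)) \<longlongrightarrow> p) (at_right 0)"
    and bound: "\<And>y. \<lbrakk>0 < y; y \<le> d\<rbrakk> \<Longrightarrow> y * cmod (deriv g (of_real x + \<i> * of_real y)) \<le> c * y powr (1 - \<beta>)"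
  shows "cmod (g (of_real x + \<i> * of_real d) - p) \<le> c / (1 - \<beta>) * d powr (1 - \<beta>)"
proof (rule tendsto_upperbound)
  let ?g = "\<lambda>y. g (of_real x + \<i> * of_real y)"
  show "((\<lambda>y. cmod (?g d - ?g y)) \<longlongrightarrow> cmod (?g d - p)) (at_right 0)"
    by (intro tendsto_intros lim)
  have "cmod (?g d - ?g e) \<le> c / (1 - \<beta>) * d powr (1 - \<beta>)" if e: "0 < e" "e < d" for e
  proof -
    have "norm (?g d - ?g e) \<le> c / (1 - \<beta>) * d powr (1 - \<beta>) - c / (1 - \<beta>) * e powr (1 - \<beta>)"
    proof (rule norm_increment_le[where f = ?g and \<phi> = "\<lambda>y. c / (1 - \<beta>) * y powr (1 - \<beta>)"])
      fix y assume y: "y \<in> {e..d}"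
      have "(g has_field_derivative deriv g (of_real x + \<i> * of_real y)) (at (of_real x + \<i> * of_real y))"
        using y e by (intro holomorphic_derivI[OF hol open_halfspace_Im_gt]) auto
      moreover have "((\<lambda>y. of_real x + \<i> * of_real y) has_vector_derivative \<i>) (at y within {e..d})"
        unfolding has_vector_derivative_def
        by (auto intro!: derivative_eq_intros simp: scaleR_conv_of_real)
      ultimately show "(?g has_vector_derivative \<i> * deriv g (of_real x + \<i> * of_real y)) (at y within {e..d})"
        using field_vector_diff_chain_within[of "\<lambda>y. of_real x + \<i> * of_real y" \<i> y "{e..d}" g]
        by (auto simp: o_def intro: DERIV_subset)
      show "((\<lambda>y. c / (1 - \<beta>) * y powr (1 - \<beta>)) has_vector_derivative c * y powr (- \<beta>)) (at y within {e..d})"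
        unfolding has_real_derivative_iff_has_vector_derivative[symmetric]
        using y e \<open>\<beta> < 1\<close> by (auto intro!: derivative_eq_intros)
      have "y powr (1 - \<beta>) = y * y powr (- \<beta>)"
        using y e by (simp add: powr_diff powr_minus divide_inverse)
      then have "y * cmod (deriv g (of_real x + \<i> * of_real y)) \<le> y * (c * y powr (- \<beta>))"
        using bound[of y] y e by (simp add: mult_ac)
      then show "norm (\<i> * deriv g (of_real x + \<i> * of_real y)) \<le> c * y powr (- \<beta>)"
        using y e by (simp add: norm_mult)
    qed (use e in auto)
    also have "\<dots> \<le> c / (1 - \<beta>) * d powr (1 - \<beta>)"
      using \<open>0 \<le> c\<close> \<open>\<beta> < 1\<close> by simp
    finally show ?thesis .
  qed
  then show "\<forall>\<^sub>F y in at_right 0. cmod (?g d - ?g y) \<le> c / (1 - \<beta>) * d powr (1 - \<beta>)"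
    using \<open>0 < d\<close> by (auto simp: eventually_at_right_field)
qed auto

section \<open>Distance of the traces\<close>

lemma eventually_powr_times_log_le:
  fixes \<eta> A B :: real
  assumes "0 < \<eta>"
  shows "\<forall>\<^sub>F d in at_right 0. d powr \<eta> * (A - B * ln d) \<le> 1"
proof -
  have "((\<lambda>d. d powr \<eta>) \<longlongrightarrow> 0) (at_right (0::real))" "((\<lambda>d. d powr \<eta> * ln d) \<longlongrightarrow> 0) (at_right (0::real))"
    using assms by real_asymp+
  from tendsto_diff[OF tendsto_mult_right_zero[OF this(1), of A] tendsto_mult_right_zero[OF this(2), of B]]
  have "((\<lambda>d. d powr \<eta> * (A - B * ln d)) \<longlongrightarrow> 0) (at_right 0)"
    by (simp add: algebra_simps)
  then show ?thesis
    using order_tendstoD(2)[of _ 0 _ 1] by (force elim: eventually_mono)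
qed

text \<open>
  The estimate for \<epsilon> = d^((3 - \<beta>) / 2), the choice that gives all three parts of the path
  from p1 to p2 through the two images of the points at height d the same order
  d^(1 - \<beta>) up to the logarithm.
\<close>
lemma loewner_trace_distance:
  assumes pair1: "loewner_pair f\<^sub>1 W\<^sub>1" and pair2: "loewner_pair f\<^sub>2 W\<^sub>2" and "0 \<le> t" "t \<le> T"
    and d: "0 < d" "d \<le> 1" and "\<beta> < 1"
    and drive: "\<And>s. s \<in> {0..t} \<Longrightarrow> \<bar>W\<^sub>1 s - W\<^sub>2 s\<bar> \<le> d powr ((3 - \<beta>) / 2)"
    and lim1: "((\<lambda>y. f\<^sub>1 t (of_real (W\<^sub>1 t) + \<i> * of_real y)) \<longlongrightarrow> p\<^sub>1) (at_right 0)"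
    and lim2: "((\<lambda>y. f\<^sub>2 t (of_real (W\<^sub>2 t) + \<i> * of_real y)) \<longlongrightarrow> p\<^sub>2) (at_right 0)"
    and bound1: "\<And>y. \<lbrakk>0 < y; y \<le> d\<rbrakk> \<Longrightarrow>
       y * cmod (deriv (f\<^sub>1 t) (of_real (W\<^sub>1 t) + \<i> * of_real y)) \<le> c * y powr (1 - \<beta>)"
    and bound2: "\<And>y. \<lbrakk>0 < y; y \<le> d\<rbrakk> \<Longrightarrow>
       y * cmod (deriv (f\<^sub>2 t) (of_real (W\<^sub>2 t) + \<i> * of_real y)) \<le> c * y powr (1 - \<beta>)"
  defines "K \<equiv> sqrt (4 * T + 1)"
  shows "cmod (p\<^sub>1 - p\<^sub>2) \<le> d powr (1 - \<beta>) * (2 * c / (1 - \<beta>) + sqrt (c * K) * (1 + ln K - ln d))"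
proof -
  define z\<^sub>1 where "z\<^sub>1 = of_real (W\<^sub>1 t) + \<i> * of_real d"
  define z\<^sub>2 where "z\<^sub>2 = of_real (W\<^sub>2 t) + \<i> * of_real d"
  have "0 \<le> d * cmod (deriv (f\<^sub>1 t) z\<^sub>1)"
    using d by simp
  also have "\<dots> \<le> c * d powr (1 - \<beta>)"
    using bound1[of d] d by (simp add: z\<^sub>1_def)
  finally have c: "0 \<le> c"
    using d by (simp add: zero_le_mult_iff)
  have hol: "f\<^sub>1 t holomorphic_on {z. 0 < Im z}" "f\<^sub>2 t holomorphic_on {z. 0 < Im z}"
    using pair1 pair2 \<open>0 \<le> t\<close> by (simp_all add: loewner_pair_def upper_half_plane_def)
  have tip1: "cmod (f\<^sub>1 t z\<^sub>1 - p\<^sub>1) \<le> c / (1 - \<beta>) * d powr (1 - \<beta>)"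
    unfolding z\<^sub>1_def
    by (rule vertical_limit_distance[OF hol(1) d(1) \<open>\<beta> < 1\<close> c lim1 bound1])
  have tip2: "cmod (f\<^sub>2 t z\<^sub>2 - p\<^sub>2) \<le> c / (1 - \<beta>) * d powr (1 - \<beta>)"
    unfolding z\<^sub>2_def
    by (rule vertical_limit_distance[OF hol(2) d(1) \<open>\<beta> < 1\<close> c lim2 bound2])
  have split: "d powr (1 - \<beta>) = d * d powr (- \<beta>)"
    using d by (simp add: powr_diff powr_minus divide_inverse)
  have D: "cmod (deriv (f\<^sub>1 t) z\<^sub>1) \<le> c * d powr (- \<beta>)" "cmod (deriv (f\<^sub>2 t) z\<^sub>2) \<le> c * d powr (- \<beta>)"
    using bound1[of d] bound2[of d] d unfolding split z\<^sub>1_def z\<^sub>2_def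
    by (simp_all add: mult.left_commute[of c])
  have "d\<^sup>2 \<le> 1"
    using d by (simp add: power_le_one)
  then have R: "sqrt (4 * t + d\<^sup>2) / d \<le> K / d"
    unfolding K_def using d \<open>t \<le> T\<close> by (intro divide_right_mono real_sqrt_le_mono) auto
  have "1 \<le> K"
    using \<open>0 \<le> t\<close> \<open>t \<le> T\<close> by (simp add: K_def)
  have "cmod (f\<^sub>1 t z\<^sub>1 - f\<^sub>2 t z\<^sub>2)
      \<le> d powr ((3 - \<beta>) / 2) * sqrt (c * d powr (- \<beta>) * (K / d)) * (1 + ln (K / d))"
    unfolding z\<^sub>1_def z\<^sub>2_def
    by (rule loewner_compare[OF pair1 pair2 \<open>0 \<le> t\<close> d(1) drive D[unfolded z\<^sub>1_def z\<^sub>2_def] R])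
  also have "d powr ((3 - \<beta>) / 2) * sqrt (c * d powr (- \<beta>) * (K / d)) = d powr (1 - \<beta>) * sqrt (c * K)"
  proof -
    have "d powr (- \<beta>) / d = (d powr (- (1 + \<beta>) / 2))\<^sup>2"
    proof -
      have "(d powr (- (1 + \<beta>) / 2))\<^sup>2 = d powr (- (1 + \<beta>))"
        by (simp add: power2_eq_square flip: powr_add)
      also have "\<dots> = d powr (- \<beta>) / d"
        using d powr_diff[of d "- \<beta>" 1] by (simp add: add.commute[of 1])
      finally show ?thesis ..
    qed
    then have "sqrt (c * d powr (- \<beta>) * (K / d)) = sqrt (c * K * (d powr (- (1 + \<beta>) / 2))\<^sup>2)"
      by (metis (no_types, lifting) mult.assoc mult.commute times_divide_eq_right)
    also have "\<dots> = sqrt (c * K) * d powr (- (1 + \<beta>) / 2)"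
      by (simp add: real_sqrt_mult)
    finally have root: "sqrt (c * d powr (- \<beta>) * (K / d)) = sqrt (c * K) * d powr (- (1 + \<beta>) / 2)" .
    have "d powr ((3 - \<beta>) / 2) * d powr (- (1 + \<beta>) / 2) = d powr (1 - \<beta>)"
      unfolding powr_add[symmetric] by (rule arg_cong) (simp add: field_simps)
    then show ?thesis
      unfolding root by (metis mult.assoc mult.commute)
  qed
  also have "ln (K / d) = ln K - ln d"
    using d \<open>1 \<le> K\<close> by (simp add: ln_div)
  finally have mid: "cmod (f\<^sub>1 t z\<^sub>1 - f\<^sub>2 t z\<^sub>2) \<le> d powr (1 - \<beta>) * sqrt (c * K) * (1 + (ln K - ln d))" .
  have "cmod (p\<^sub>1 - p\<^sub>2) \<le> cmod (p\<^sub>1 - f\<^sub>1 t z\<^sub>1) + cmod (f\<^sub>1 t z\<^sub>1 - f\<^sub>2 t z\<^sub>2) + cmod (f\<^sub>2 t z\<^sub>2 - p\<^sub>2)"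
    by norm
  moreover have "d powr (1 - \<beta>) * (2 * c / (1 - \<beta>) + sqrt (c * K) * (1 + ln K - ln d))
      = 2 * (c / (1 - \<beta>) * d powr (1 - \<beta>)) + d powr (1 - \<beta>) * sqrt (c * K) * (1 + (ln K - ln d))"
    by (simp add: algebra_simps)
  ultimately show ?thesis
    using tip1 tip2 mid norm_minus_commute[of p\<^sub>1 "f\<^sub>1 t z\<^sub>1"] by linarith
qed

theorem corollary2p6:
  fixes T r :: real
  assumes "T \<ge> 0"
  shows "\<exists>c'::real. \<forall>(d\<^sub>0::real) (c::real) (\<beta>::real).
           d\<^sub>0 > 0 \<longrightarrow> \<beta> < 1 \<longrightarrow> r < 2 * ((1 - \<beta>) / (3 - \<beta>)) \<longrightarrow>
           (\<exists>\<epsilon>\<^sub>0>0. \<forall>(\<epsilon>::real)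
               (f :: nat \<Rightarrow> real \<Rightarrow> complex \<Rightarrow> complex) (W :: nat \<Rightarrow> real \<Rightarrow> real)
               (\<gamma> :: nat \<Rightarrow> real \<Rightarrow> complex).
             0 < \<epsilon> \<longrightarrow> \<epsilon> < \<epsilon>\<^sub>0 \<longrightarrow>
             (\<forall>j\<in>{1, 2}. loewner_pair (f j) (W j) \<and> generated_by_curve T (f j) (W j) (\<gamma> j)) \<longrightarrow>
             (\<forall>t\<in>{0..T}. \<bar>W 1 t - W 2 t\<bar> \<le> \<epsilon>) \<longrightarrow>
             (\<forall>j\<in>{1, 2}. \<forall>d. 0 < d \<and> d \<le> d\<^sub>0 \<longrightarrow>
                (\<forall>t\<in>{0..T}.
                   d * cmod (deriv (f j t) (of_real (W j t) + \<i> * of_real d)) \<le> c * d powr (1 - \<beta>))) \<longrightarrow>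
             (\<forall>t\<in>{0..T}. cmod (\<gamma> 1 t - \<gamma> 2 t) \<le> c' * \<epsilon> powr r))"
proof (rule exI[of _ 1], intro allI impI)
  fix d\<^sub>0 c \<beta> :: real
  assume "0 < d\<^sub>0" "\<beta> < 1" and r: "r < 2 * ((1 - \<beta>) / (3 - \<beta>))"
  define K where "K = sqrt (4 * T + 1)"
  \<comment> \<open>In terms of d the error is of order d^(1 - \<open>\<beta>\<close>) and the target \<open>\<epsilon>\<close>^r equals
    d^(r (3 - \<open>\<beta>\<close>) / 2); \<open>\<eta>\<close> is the gain left to absorb the constants and the logarithm.\<close>
  define \<eta> where "\<eta> = (1 - \<beta>) - r * (3 - \<beta>) / 2"
  have "0 < \<eta>"
    using r \<open>\<beta> < 1\<close> by (simp add: \<eta>_def field_simps)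
  from eventually_powr_times_log_le[OF this, of "2 * c / (1 - \<beta>) + sqrt (c * K) * (1 + ln K)" "sqrt (c * K)"]
  obtain \<delta> where \<delta>: "0 < \<delta>"
    "\<And>d. 0 < d \<Longrightarrow> d < \<delta> \<Longrightarrow> d powr \<eta> * (2 * c / (1 - \<beta>) + sqrt (c * K) * (1 + ln K) - sqrt (c * K) * ln d) \<le> 1"
    by (auto simp: eventually_at_right_field)
  define \<epsilon>\<^sub>0 where "\<epsilon>\<^sub>0 = min \<delta> (min d\<^sub>0 1) powr ((3 - \<beta>) / 2)"
  show "\<exists>\<epsilon>\<^sub>0>0. \<forall>(\<epsilon>::real) (f :: nat \<Rightarrow> real \<Rightarrow> complex \<Rightarrow> complex) (W :: nat \<Rightarrow> real \<Rightarrow> real)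
               (\<gamma> :: nat \<Rightarrow> real \<Rightarrow> complex).
             0 < \<epsilon> \<longrightarrow> \<epsilon> < \<epsilon>\<^sub>0 \<longrightarrow>
             (\<forall>j\<in>{1, 2}. loewner_pair (f j) (W j) \<and> generated_by_curve T (f j) (W j) (\<gamma> j)) \<longrightarrow>
             (\<forall>t\<in>{0..T}. \<bar>W 1 t - W 2 t\<bar> \<le> \<epsilon>) \<longrightarrow>
             (\<forall>j\<in>{1, 2}. \<forall>d. 0 < d \<and> d \<le> d\<^sub>0 \<longrightarrow>
                (\<forall>t\<in>{0..T}.
                   d * cmod (deriv (f j t) (of_real (W j t) + \<i> * of_real d)) \<le> c * d powr (1 - \<beta>))) \<longrightarrow>
             (\<forall>t\<in>{0..T}. cmod (\<gamma> 1 t - \<gamma> 2 t) \<le> 1 * \<epsilon> powr r)"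
  proof (intro exI[of _ \<epsilon>\<^sub>0] conjI allI impI ballI)
    show "0 < \<epsilon>\<^sub>0"
      using \<delta>(1) \<open>0 < d\<^sub>0\<close> by (simp add: \<epsilon>\<^sub>0_def)
    fix \<epsilon> t :: real and f :: "nat \<Rightarrow> real \<Rightarrow> complex \<Rightarrow> complex" and W :: "nat \<Rightarrow> real \<Rightarrow> real"
      and \<gamma> :: "nat \<Rightarrow> real \<Rightarrow> complex"
    assume eps: "0 < \<epsilon>" "\<epsilon> < \<epsilon>\<^sub>0" and t: "t \<in> {0..T}"
      and pair: "\<forall>j\<in>{1, 2}. loewner_pair (f j) (W j) \<and> generated_by_curve T (f j) (W j) (\<gamma> j)"
      and drive: "\<forall>t\<in>{0..T}. \<bar>W 1 t - W 2 t\<bar> \<le> \<epsilon>"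
      and bound: "\<forall>j\<in>{1, 2}. \<forall>d. 0 < d \<and> d \<le> d\<^sub>0 \<longrightarrow> (\<forall>t\<in>{0..T}.
            d * cmod (deriv (f j t) (of_real (W j t) + \<i> * of_real d)) \<le> c * d powr (1 - \<beta>))"
    define d where "d = \<epsilon> powr (2 / (3 - \<beta>))"
    have eps_d: "\<epsilon> = d powr ((3 - \<beta>) / 2)"
    proof -
      have one: "2 / (3 - \<beta>) * ((3 - \<beta>) / 2) = 1"
        using \<open>\<beta> < 1\<close> by simp
      show ?thesis
        unfolding d_def powr_powr one using eps by simp
    qed
    have "0 < d"
      using eps by (simp add: d_def)
    have "d < min \<delta> (min d\<^sub>0 1)"
    proof (rule ccontr)
      assume "\<not> d < min \<delta> (min d\<^sub>0 1)"
      then have "\<epsilon>\<^sub>0 \<le> \<epsilon>"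
        unfolding \<epsilon>\<^sub>0_def eps_d using \<open>\<beta> < 1\<close> \<delta>(1) \<open>0 < d\<^sub>0\<close> by (intro powr_mono2) auto
      then show False
        using eps by simp
    qed
    then have d: "d < \<delta>" "d \<le> d\<^sub>0" "d \<le> 1"
      by auto
    have "cmod (\<gamma> 1 t - \<gamma> 2 t) \<le> d powr (1 - \<beta>) * (2 * c / (1 - \<beta>) + sqrt (c * K) * (1 + ln K - ln d))"
      unfolding K_def
    proof (rule loewner_trace_distance)
      show "loewner_pair (f 1) (W 1)" "loewner_pair (f 2) (W 2)"
        using pair by auto
      show "((\<lambda>y. f 1 t (of_real (W 1 t) + \<i> * of_real y)) \<longlongrightarrow> \<gamma> 1 t) (at_right 0)"
        "((\<lambda>y. f 2 t (of_real (W 2 t) + \<i> * of_real y)) \<longlongrightarrow> \<gamma> 2 t) (at_right 0)"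
        using pair t by (auto simp: generated_by_curve_def)
      show "\<bar>W 1 s - W 2 s\<bar> \<le> d powr ((3 - \<beta>) / 2)" if "s \<in> {0..t}" for s
        using drive that t unfolding eps_d[symmetric] by auto
    qed (use t \<open>0 < d\<close> d \<open>\<beta> < 1\<close> bound in auto)
    also have "d powr (1 - \<beta>) = \<epsilon> powr r * d powr \<eta>"
      unfolding eps_d powr_powr powr_add[symmetric]
      by (rule arg_cong[where f = "(powr) d"]) (simp add: \<eta>_def mult.commute)
    also have "\<epsilon> powr r * d powr \<eta> * (2 * c / (1 - \<beta>) + sqrt (c * K) * (1 + ln K - ln d)) \<le> \<epsilon> powr r * 1"
      using mult_left_mono[OF \<delta>(2)[OF \<open>0 < d\<close> d(1)], of "\<epsilon> powr r"] by (simp add: algebra_simps)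
    finally show "cmod (\<gamma> 1 t - \<gamma> 2 t) \<le> 1 * \<epsilon> powr r"
      by simp
  qed
qed

end
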